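(* For every $\tilde{\boldsymbol y}\in Y$ and $i\in I(\tilde{\boldsymbol y})$ let $M_i(\tilde{\boldsymbol y})\ge 0$ be a coefficient, and assume that $$\varphi(\tilde{\boldsymbol y}^{\,S})\;\ge\;\varphi(\tilde{\boldsymbol y})-\sum_{i\in S}M_i(\tilde{\boldsymbol y})\qquad\text{for all }\tilde{\boldsymbol y}\in Y\text{ and all }S\subseteq I(\tilde{\boldsymbol y}),$$ where $\tilde{\boldsymbol y}^{\,S}$ is obtained from $\tilde{\boldsymbol y}$ by setting $\tilde y_i=0$ for all $i\in S$. Then a vector $\boldsymbol x\in\{0,1\}^m$ satisfies every inequality $$t\;\ge\;\varphi(\tilde{\boldsymbol y})-\sum_{i\in I(\tilde{\boldsymbol y})}M_i(\tilde{\boldsymbol y})\,x_i,\qquad \tilde{\boldsymbol y}\in Y,$$ if and only if $t\ge\xi(\boldsymbol x)$.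
   Context: Data: $I=\{1,\dots,m\}$ is a finite set of candidate facility locations and $J=\{1,\dots,n\}$ a finite set of customers. Each $i\in I$ has an opening cost $f_i\ge 0$; each $j\in J$ has a weight $d_j>0$; $p_{ij}\in[0,1]$ is the coverage level provided by location $i$ to customer $j$; $b\ge 0$ is the opening budget and $t\ge 0$ the target coverage. Let $I_j=\{i\in I: 0<p_{ij}\le 1\}$. For $\boldsymbol y\in\{0,1\}^m$ let $I(\boldsymbol y)=\{i\in I:y_i=1\}$ and $I_j(\boldsymbol y)=I_j\cap I(\boldsymbol y)$. The (max-min) coverage of customer $j$ is $r_j(\boldsymbol y)=\min_{i\in I_j(\boldsymbol y)}p_{ij}$ if $I_j(\boldsymbol y)\neq\varnothing$, and $r_j(\boldsymbol y)=0$ otherwise. The total coverage is $\varphi(\boldsymbol y)=\sum_{j\in J}d_j r_j(\boldsymbol y)$. Let $Y=\{\boldsymbol y\in\{0,1\}^m:\sum_{i\in I}f_iy_i\le b\}$. For a blocker decision $\boldsymbol x\in\{0,1\}^m$ ($x_i=1$ means location $i$ is blocked), the optimal follower value is $\xi(\boldsymbol x)=\max\{\varphi(\boldsymbol y):\boldsymbol y\in Y,\ y_i\le 1-x_i\ \text{for all } i\in I\}$. *)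

theory Defs
  imports Complex_Main "HOL-Library.FuncSet"
begin

text \<open>
  Locations are \<open>{1..m}\<close> and customers are \<open>{1..n}\<close>. A vector indexed by the locations is a
  function \<open>nat \<Rightarrow> real\<close>; binary vectors are extensional functions on \<open>{1..m}\<close>, so that equal
  components mean equal vectors and \<open>{0,1}\<^sup>m\<close> is a finite set.
\<close>

definition binary_vectors :: "nat \<Rightarrow> (nat \<Rightarrow> real) set" where
  "binary_vectors m = {1..m} \<rightarrow>\<^sub>E {0, 1}"

definition open_locs :: "nat \<Rightarrow> (nat \<Rightarrow> real) \<Rightarrow> nat set" where
  "open_locs m y = {i \<in> {1..m}. y i = 1}"

definition covering_locs :: "nat \<Rightarrow> (nat \<Rightarrow> nat \<Rightarrow> real) \<Rightarrow> nat \<Rightarrow> nat set" where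
  "covering_locs m p j = {i \<in> {1..m}. 0 < p i j \<and> p i j \<le> 1}"

definition open_covering_locs ::
  "nat \<Rightarrow> (nat \<Rightarrow> nat \<Rightarrow> real) \<Rightarrow> nat \<Rightarrow> (nat \<Rightarrow> real) \<Rightarrow> nat set" where
  "open_covering_locs m p j y = covering_locs m p j \<inter> open_locs m y"

definition customer_coverage ::
  "nat \<Rightarrow> (nat \<Rightarrow> nat \<Rightarrow> real) \<Rightarrow> nat \<Rightarrow> (nat \<Rightarrow> real) \<Rightarrow> real" where
  "customer_coverage m p j y =
     (if open_covering_locs m p j y \<noteq> {} then Min ((\<lambda>i. p i j) ` open_covering_locs m p j y) else 0)"

definition total_coverage ::
  "nat \<Rightarrow> nat \<Rightarrow> (nat \<Rightarrow> nat \<Rightarrow> real) \<Rightarrow> (nat \<Rightarrow> real) \<Rightarrow> (nat \<Rightarrow> real) \<Rightarrow> real" where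
  "total_coverage m n p d y = (\<Sum>j\<in>{1..n}. d j * customer_coverage m p j y)"

definition budget_feasible :: "nat \<Rightarrow> (nat \<Rightarrow> real) \<Rightarrow> real \<Rightarrow> (nat \<Rightarrow> real) set" where
  "budget_feasible m f b = {y \<in> binary_vectors m. (\<Sum>i\<in>{1..m}. f i * y i) \<le> b}"

definition unblocked_feasible ::
  "nat \<Rightarrow> (nat \<Rightarrow> real) \<Rightarrow> real \<Rightarrow> (nat \<Rightarrow> real) \<Rightarrow> (nat \<Rightarrow> real) set" where
  "unblocked_feasible m f b x = {y \<in> budget_feasible m f b. \<forall>i\<in>{1..m}. y i \<le> 1 - x i}"

definition follower_value ::
  "nat \<Rightarrow> nat \<Rightarrow> (nat \<Rightarrow> real) \<Rightarrow> real \<Rightarrow> (nat \<Rightarrow> nat \<Rightarrow> real) \<Rightarrow> (nat \<Rightarrow> real) \<Rightarrow> (nat \<Rightarrow> real) \<Rightarrow> real" where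
  "follower_value m n f b p d x = Max (total_coverage m n p d ` unblocked_feasible m f b x)"

definition close_locs :: "nat set \<Rightarrow> (nat \<Rightarrow> real) \<Rightarrow> (nat \<Rightarrow> real)" where
  "close_locs S y = (\<lambda>i. if i \<in> S then 0 else y i)"

text \<open>
  The feasible set of the follower is finite and, for a binary blocker decision, nonempty (it
  contains the zero vector), so the \<open>Max\<close> in \<open>follower_value\<close> is a genuine maximum.
\<close>

lemma finite_unblocked_feasible: "finite (unblocked_feasible m f b x)"
proof -
  have "finite (binary_vectors m)"
    unfolding binary_vectors_def by (rule finite_PiE) auto
  then show ?thesis
    by (rule rev_finite_subset) (auto simp: unblocked_feasible_def budget_feasible_def)
qed

lemma unblocked_feasible_nonempty:
  assumes "b \<ge> 0" and "x \<in> binary_vectors m"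
  shows "unblocked_feasible m f b x \<noteq> {}"
proof -
  have "x i \<le> 1" if "i \<in> {1..m}" for i
    using PiE_mem[OF assms(2)[unfolded binary_vectors_def] that] by auto
  then have "(\<lambda>i\<in>{1..m}. 0) \<in> unblocked_feasible m f b x"
    using assms(1)
    by (auto simp: unblocked_feasible_def budget_feasible_def binary_vectors_def)
  then show ?thesis by blast
qed

end

theory Submission
  imports Defs
begin

text \<open>
  Bounding \<open>\<xi>(x)\<close> by \<open>t\<close> means bounding \<open>\<phi>\<close> by \<open>t\<close> on every feasible \<open>y\<close> that avoids the blocked
  locations. Such a \<open>y\<close> has no open location \<open>i\<close> with \<open>x i = 1\<close>, so the correction term of its
  inequality vanishes and the inequality says exactly \<open>\<phi>(y) \<le> t\<close>; hence the family of inequalities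
  implies the bound.

  Conversely, take an arbitrary feasible \<open>y\<close> and close the set \<open>S\<close> of its open locations that are
  blocked by \<open>x\<close>. Opening costs are nonnegative, so the result is still within the budget, and it
  avoids the blocked locations; its coverage is therefore at most \<open>t\<close>. The assumption on the
  coefficients, for this very \<open>S\<close>, bounds that coverage below by \<open>\<phi>(y)\<close> minus the sum of \<open>M y i\<close>
  over \<open>S\<close>, and since \<open>x\<close> is the indicator of the blocked locations this is the right-hand side
  of the inequality of \<open>y\<close>.

  Since \<open>x\<close> is itself a binary vector, the set of blocked locations is written \<open>open_locs m x\<close>.
\<close>

lemma binary_vectors_cases:
  assumes "y \<in> binary_vectors m" and "i \<in> {1..m}"
  shows "y i = 0 \<or> y i = 1"
  using PiE_mem[OF assms[unfolded binary_vectors_def]] by auto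

lemma follower_value_le_iff:
  assumes "b \<ge> 0" and "x \<in> binary_vectors m"
  shows "follower_value m n f b p d x \<le> t \<longleftrightarrow>
    (\<forall>y\<in>unblocked_feasible m f b x. total_coverage m n p d y \<le> t)"
  unfolding follower_value_def
  using finite_unblocked_feasible unblocked_feasible_nonempty[OF assms] by simp

lemma open_disjoint_blocked:
  assumes "y \<in> unblocked_feasible m f b x"
  shows "open_locs m y \<inter> open_locs m x = {}"
proof -
  have "y i \<le> 1 - x i" if "i \<in> {1..m}" for i
    using assms that by (simp add: unblocked_feasible_def)
  then show ?thesis
    by (force simp: open_locs_def)
qed

lemma sum_weighted_by_blocker:
  assumes "x \<in> binary_vectors m"
  shows "(\<Sum>i\<in>open_locs m y. c i * x i) = (\<Sum>i\<in>open_locs m y \<inter> open_locs m x. c i)"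
proof -
  have "(\<Sum>i\<in>open_locs m y. c i * x i) = (\<Sum>i\<in>open_locs m y \<inter> open_locs m x. c i * x i)"
    by (rule sum.mono_neutral_right)
      (use binary_vectors_cases[OF assms] in \<open>auto simp: open_locs_def\<close>)
  then show ?thesis
    by (simp add: open_locs_def)
qed

text \<open>
  Closing locations never increases the opening cost because \<open>f \<ge> 0\<close>; and after closing, a location
  that is still open is not blocked, which for binary vectors is the constraint \<open>y i \<le> 1 - x i\<close>.
\<close>

lemma close_blocked_unblocked_feasible:
  assumes f: "\<And>i. i \<in> {1..m} \<Longrightarrow> f i \<ge> 0"
    and x: "x \<in> binary_vectors m"
    and y: "y \<in> budget_feasible m f b"
  shows "close_locs (open_locs m y \<inter> open_locs m x) y \<in> unblocked_feasible m f b x"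
    (is "?z \<in> _")
proof -
  have ybin: "y \<in> binary_vectors m" and cost: "(\<Sum>i\<in>{1..m}. f i * y i) \<le> b"
    using y by (auto simp: budget_feasible_def)
  have "?z \<in> binary_vectors m"
    using ybin by (auto simp: binary_vectors_def close_locs_def open_locs_def PiE_iff extensional_def)
  moreover have "(\<Sum>i\<in>{1..m}. f i * ?z i) \<le> (\<Sum>i\<in>{1..m}. f i * y i)"
    by (rule sum_mono)
      (use f binary_vectors_cases[OF ybin] in \<open>auto simp: close_locs_def open_locs_def\<close>)
  moreover have "?z i \<le> 1 - x i" if "i \<in> {1..m}" for i
    using binary_vectors_cases[OF ybin that] binary_vectors_cases[OF x that] that
    by (auto simp: close_locs_def open_locs_def)
  ultimately show ?thesis
    using cost by (auto simp: unblocked_feasible_def budget_feasible_def)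
qed

theorem proposition1:
  fixes m n :: nat
    and f d :: "nat \<Rightarrow> real"
    and p :: "nat \<Rightarrow> nat \<Rightarrow> real"
    and b t :: real
    and M :: "(nat \<Rightarrow> real) \<Rightarrow> nat \<Rightarrow> real"
    and x :: "nat \<Rightarrow> real"
  assumes "\<And>i. i \<in> {1..m} \<Longrightarrow> f i \<ge> 0"
    and "\<And>j. j \<in> {1..n} \<Longrightarrow> d j > 0"
    and "\<And>i j. i \<in> {1..m} \<Longrightarrow> j \<in> {1..n} \<Longrightarrow> 0 \<le> p i j \<and> p i j \<le> 1"
    and "b \<ge> 0"
    and "t \<ge> 0"
    and "\<And>y i. y \<in> budget_feasible m f b \<Longrightarrow> i \<in> open_locs m y \<Longrightarrow> M y i \<ge> 0"
    and "\<And>y S. y \<in> budget_feasible m f b \<Longrightarrow> S \<subseteq> open_locs m y \<Longrightarrow>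
           total_coverage m n p d (close_locs S y) \<ge> total_coverage m n p d y - (\<Sum>i\<in>S. M y i)"
    and "x \<in> binary_vectors m"
  shows "(\<forall>y\<in>budget_feasible m f b.
            t \<ge> total_coverage m n p d y - (\<Sum>i\<in>open_locs m y. M y i * x i))
         \<longleftrightarrow> t \<ge> follower_value m n f b p d x"
proof -
  let ?S = "\<lambda>y. open_locs m y \<inter> open_locs m x"
  note x = \<open>x \<in> binary_vectors m\<close>
  have "(\<forall>y\<in>budget_feasible m f b. total_coverage m n p d y - (\<Sum>i\<in>?S y. M y i) \<le> t) \<longleftrightarrow>
    (\<forall>y\<in>unblocked_feasible m f b x. total_coverage m n p d y \<le> t)" (is "?cuts \<longleftrightarrow> ?bound")
  proof (intro iffI ballI)
    fix y assume ?cuts and y: "y \<in> unblocked_feasible m f b x"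
    then have "total_coverage m n p d y - (\<Sum>i\<in>?S y. M y i) \<le> t"
      by (simp add: unblocked_feasible_def)
    then show "total_coverage m n p d y \<le> t"
      by (simp add: open_disjoint_blocked[OF y])
  next
    fix y assume ?bound and y: "y \<in> budget_feasible m f b"
    have "total_coverage m n p d y - (\<Sum>i\<in>?S y. M y i) \<le> total_coverage m n p d (close_locs (?S y) y)"
      by (rule assms(7)[OF y]) simp
    also have "\<dots> \<le> t"
      using \<open>?bound\<close> close_blocked_unblocked_feasible[OF assms(1) x y] by blast
    finally show "total_coverage m n p d y - (\<Sum>i\<in>?S y. M y i) \<le> t" .
  qed
  then show ?thesis
    by (simp only: sum_weighted_by_blocker[OF x] follower_value_le_iff[OF \<open>b \<ge> 0\<close> x])
qed

end
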